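(* Let $D$ be a simple digraph on $n$ vertices, and let $K_n$ be the complete simple digraph on $n$ vertices. Then $P_D$ is a subpolytope of $P_{K_n}$ (i.e. $P_D\subseteq P_{K_n}$). In particular, if $D$ is strongly connected, then $P_D$ has exactly one interior lattice point.
   Context: A digraph $D$ is a finite directed graph on the vertex set $[n]=\{1,\ldots,n\}$, without loops and without isolated vertices (vertices with indegree and outdegree both zero). It is simple if for any $i\ne j$ there is at most one directed edge from $i$ to $j$ (both an edge from $i$ to $j$ and one from $j$ to $i$ are allowed). The complete simple digraph $K_n$ has exactly one edge $(i,j)$ for every ordered pair $i\ne j$. $D$ is strongly connected if it contains a directed path from $i$ to $j$ for every pair of vertices $i,j$. Let $a_{i,j}$ be the number of directed edges from $i$ (tail) to $j$ (head), and $\mathrm{outdeg}(i)=\sum_j a_{i,j}$. The Laplacian matrix of $D$ is $L(D)=O(D)-A(D)$, where $A(D)=(a_{i,j})$ and $O(D)$ is the diagonal matrix with entries $\mathrm{outdeg}(i)$. The Laplacian polytope of $D$ is $P_D=\operatorname{conv}\{\mathbf{v}_1,\ldots,\mathbf{v}_n\}\subset\mathbb{R}^n$, where $\mathbf{v}_i$ is the $i$-th row of $L(D)$. An interior lattice point of $P_D$ is a point of $\mathbb{Z}^n$ in the relative interior of $P_D$. *)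

theory Defs
  imports "HOL-Analysis.Analysis" "Graph_Theory.Digraph_Component" "Graph_Theory.Kuratowski"
begin

text \<open>
  The vertex set \<open>[n]\<close> is rendered by a finite type \<open>'n\<close> with \<open>n = CARD('n)\<close>, so that the rows of
  the Laplacian matrix live in \<open>real ^ 'n\<close>.  Arcs are elements of an arbitrary type, hence parallel
  arcs are possible unless \<^locale>\<open>nomulti_digraph\<close> is assumed; that locale still allows a pair
  of opposite arcs.
\<close>

locale laplacian_digraph = fin_digraph D + loopfree_digraph D
  for D :: "('n::finite, 'e) pre_digraph" +
  assumes verts_UNIV: "verts D = UNIV"
    and no_isolated: "\<not> (in_degree D v = 0 \<and> out_degree D v = 0)"

locale simple_laplacian_digraph = laplacian_digraph D + nomulti_digraph D
  for D :: "('n::finite, 'e) pre_digraph"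

definition arc_mult :: "('n, 'e) pre_digraph \<Rightarrow> 'n \<Rightarrow> 'n \<Rightarrow> nat" where
  "arc_mult D i j = card {e \<in> arcs D. tail D e = i \<and> head D e = j}"

definition adjacency_matrix :: "('n::finite, 'e) pre_digraph \<Rightarrow> real ^ 'n ^ 'n" where
  "adjacency_matrix D = (\<chi> i j. real (arc_mult D i j))"

definition outdegree_matrix :: "('n::finite, 'e) pre_digraph \<Rightarrow> real ^ 'n ^ 'n" where
  "outdegree_matrix D = (\<chi> i j. if i = j then real (\<Sum>k\<in>UNIV. arc_mult D i k) else 0)"

definition laplacian_matrix :: "('n::finite, 'e) pre_digraph \<Rightarrow> real ^ 'n ^ 'n" where
  "laplacian_matrix D = outdegree_matrix D - adjacency_matrix D"

definition laplacian_polytope :: "('n::finite, 'e) pre_digraph \<Rightarrow> (real ^ 'n) set" where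
  "laplacian_polytope D = convex hull (rows (laplacian_matrix D))"

definition interior_lattice_points :: "(real ^ 'n) set \<Rightarrow> (real ^ 'n) set" where
  "interior_lattice_points P = {x \<in> rel_interior P. \<forall>i. x $ i \<in> \<int>}"

text \<open>The sum of the multiplicities used above is the library's \<^const>\<open>out_degree\<close>.\<close>

lemma (in laplacian_digraph) sum_arc_mult: "(\<Sum>k\<in>UNIV. arc_mult D i k) = out_degree D i"
proof -
  have "out_arcs D i = (\<Union>k\<in>UNIV. {e \<in> arcs D. tail D e = i \<and> head D e = k})"
    by (auto simp: out_arcs_def)
  moreover have "card \<dots> = (\<Sum>k\<in>UNIV. arc_mult D i k)"
    unfolding arc_mult_def by (rule card_UN_disjoint) auto
  ultimately show ?thesis
    by (simp add: out_degree_def)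
qed

text \<open>
  The library predicate \<^const>\<open>complete_digraph\<close> with \<open>n = CARD('n)\<close> forces the vertex set to be all
  of \<open>'n\<close>, and it is satisfiable.
\<close>

lemma complete_digraph_verts_UNIV:
  fixes K :: "('n::finite, 'e) pre_digraph"
  assumes "complete_digraph CARD('n) K"
  shows "verts K = UNIV"
  using assms by (intro card_subset_eq) (auto simp: complete_digraph_def)

lemma complete_digraph_witness:
  "complete_digraph CARD('n)
     \<lparr>verts = (UNIV :: 'n::finite set), arcs = {(i, j). i \<noteq> j}, tail = fst, head = snd\<rparr>"
  unfolding complete_digraph_def
proof (intro conjI)
  show "graph \<lparr>verts = (UNIV :: 'n set), arcs = {(i, j). i \<noteq> j}, tail = fst, head = snd\<rparr>"
    by unfold_locales (auto simp: arc_to_ends_def symmetric_conv)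
qed (auto simp: arcs_ends_conv image_iff)

end

theory Submission
  imports Defs
begin

text \<open>
  The polytope of the complete digraph is the simplex of all \<open>x\<close> with coordinate sum \<open>0\<close> and all
  coordinates at least \<open>-1\<close>; the rows of the Laplacian of a simple digraph lie in it.  A relative
  interior point of \<open>P\<^sub>D\<close> cannot have a coordinate \<open>j\<close> equal to the minimal value \<open>-1\<close>, because the
  \<open>j\<close>-th row has a nonnegative \<open>j\<close>-th coordinate.  So an interior lattice point has nonnegative
  coordinates that add up to \<open>0\<close>, hence it is the origin.  Conversely, if the origin were not
  interior, then some functional \<open>a\<close> would be nonnegative, but not identically zero, on the rows;
  by the discrete maximum principle, strong connectivity makes \<open>a\<close> constant, and a constant
  functional vanishes on all rows.
\<close>

lemma (in nomulti_digraph) arc_mult_eq: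
  "arc_mult G i j = (if (i, j) \<in> arcs_ends G then 1 else 0)"
proof (cases "(i, j) \<in> arcs_ends G")
  case True
  then obtain e where e: "e \<in> arcs G" "tail G e = i" "head G e = j"
    by (auto simp: arcs_ends_conv)
  then have "{e \<in> arcs G. tail G e = i \<and> head G e = j} = {e}"
    using no_multi_arcs by (fastforce simp: arc_to_ends_def)
  then show ?thesis
    using True by (simp add: arc_mult_def)
next
  case False
  then have "{e \<in> arcs G. tail G e = i \<and> head G e = j} = {}"
    by (auto simp: arcs_ends_conv)
  with False show ?thesis
    by (metis arc_mult_def card.empty)
qed

lemma (in loopfree_digraph) arc_mult_diag: "arc_mult G i i = 0"
proof -
  have "{e \<in> arcs G. tail G e = i \<and> head G e = i} = {}"
    by (auto dest: no_loops)
  then show ?thesis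
    by (metis arc_mult_def card.empty)
qed

lemma laplacian_matrix_nth:
  "laplacian_matrix D $ i $ j =
    (if i = j then \<Sum>k\<in>UNIV. real (arc_mult D i k) else 0) - real (arc_mult D i j)"
  by (simp add: laplacian_matrix_def outdegree_matrix_def adjacency_matrix_def)

lemma laplacian_polytope_alt:
  "laplacian_polytope D = convex hull (range (\<lambda>i. laplacian_matrix D $ i))"
  by (simp add: laplacian_polytope_def rows_def row_def full_SetCompr_eq)

lemma laplacian_row_in_polytope: "laplacian_matrix D $ i \<in> laplacian_polytope D"
  unfolding laplacian_polytope_alt by (intro hull_inc rangeI)

text \<open>The diagonal entry collects the multiplicities of the whole row, so the pairing turns
  into a weighted sum of differences. In this form a constant \<open>a\<close> visibly annihilates
  every row, and at a minimum of \<open>a\<close> all terms have the same sign.\<close>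

lemma inner_laplacian_row:
  "a \<bullet> laplacian_matrix D $ i = (\<Sum>j\<in>UNIV. real (arc_mult D i j) * (a $ i - a $ j))"
proof -
  have "a \<bullet> laplacian_matrix D $ i =
    (\<Sum>j\<in>UNIV. (if i = j then a $ j * (\<Sum>k\<in>UNIV. real (arc_mult D i k)) else 0)
      - real (arc_mult D i j) * a $ j)"
    unfolding inner_vec_def
    by (intro sum.cong refl) (auto simp: laplacian_matrix_nth right_diff_distrib mult.commute)
  also have "\<dots> = a $ i * (\<Sum>k\<in>UNIV. real (arc_mult D i k))
      - (\<Sum>j\<in>UNIV. real (arc_mult D i j) * a $ j)"
    by (simp add: sum_subtractf)
  also have "\<dots> = (\<Sum>j\<in>UNIV. real (arc_mult D i j) * (a $ i - a $ j))"
    by (simp add: right_diff_distrib sum_subtractf sum_distrib_left mult.commute)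
  finally show ?thesis .
qed

lemma sum_laplacian_row: "(\<Sum>j\<in>UNIV. laplacian_matrix D $ i $ j) = 0"
  by (simp add: laplacian_matrix_nth sum_subtractf)

context
  fixes D :: "('n::finite, 'e) pre_digraph"
  assumes D: "nomulti_digraph D" "loopfree_digraph D"
begin

lemma laplacian_diag_nonneg: "laplacian_matrix D $ i $ i \<ge> 0"
  by (simp add: laplacian_matrix_nth loopfree_digraph.arc_mult_diag[OF D(2)] sum_nonneg)

text \<open>Off the diagonal the entry is minus a multiplicity, and without parallel arcs a
  multiplicity is 0 or 1.\<close>

lemma laplacian_row_ge: "laplacian_matrix D $ i $ j \<ge> - 1"
proof (cases "i = j")
  case True
  then show ?thesis
    using laplacian_diag_nonneg[of i] by simp
next
  case False
  then show ?thesis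
    by (simp add: laplacian_matrix_nth nomulti_digraph.arc_mult_eq[OF D(1)])
qed

lemma laplacian_polytope_subset_simplex:
  "laplacian_polytope D \<subseteq> {x. (\<Sum>j\<in>UNIV. x $ j) = 0 \<and> (\<forall>j. x $ j \<ge> - 1)}" (is "_ \<subseteq> ?S")
proof -
  have "convex ?S"
  proof (rule convexI, clarsimp, intro conjI allI)
    fix x y :: "real ^ 'n" and u v :: real and j
    assume *: "0 \<le> u" "0 \<le> v" "u + v = 1"
    {
      assume "(\<Sum>j\<in>UNIV. x $ j) = 0" "(\<Sum>j\<in>UNIV. y $ j) = 0"
      then show "(\<Sum>j\<in>UNIV. u * x $ j + v * y $ j) = 0"
        by (simp add: sum.distrib flip: sum_distrib_left)
    next
      assume "\<forall>j. - 1 \<le> x $ j" "\<forall>j. - 1 \<le> y $ j"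
      then have "u * (- 1) + v * (- 1) \<le> u * x $ j + v * y $ j"
        using * by (intro add_mono mult_left_mono) auto
      then show "- 1 \<le> u * x $ j + v * y $ j"
        using * by simp
    }
  qed
  then show ?thesis
    unfolding laplacian_polytope_alt
    using sum_laplacian_row laplacian_row_ge by (intro hull_minimal) auto
qed

lemma rel_interior_laplacian_polytope_gt:
  assumes x: "x \<in> rel_interior (laplacian_polytope D)"
  shows "x $ j > - 1"
proof (rule ccontr)
  assume "\<not> x $ j > - 1"
  moreover have "x \<in> laplacian_polytope D"
    using x rel_interior_subset by blast
  ultimately have xj: "x $ j = - 1"
    using laplacian_polytope_subset_simplex by (force intro: antisym)
  let ?z = "laplacian_matrix D $ j"
  have conv: "convex (laplacian_polytope D)"
    by (simp add: laplacian_polytope_def)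
  \<comment> \<open>A segment from row \<open>j\<close> to the relative interior point
    \<open>x\<close> can be prolonged beyond \<open>x\<close> inside the polytope. The prolonged
    point has \<open>j\<close>-th coordinate \<open>(1 - e) * ?z $ j - e\<close>, which falls below
    \<open>-1\<close> because \<open>?z $ j\<close> is nonnegative.\<close>
  obtain e where e: "e > 1" "(1 - e) *\<^sub>R ?z + e *\<^sub>R x \<in> laplacian_polytope D"
    using convex_rel_interior_iff[OF conv] laplacian_row_in_polytope x by (metis empty_iff)
  then have "- 1 \<le> ((1 - e) *\<^sub>R ?z + e *\<^sub>R x) $ j"
    using laplacian_polytope_subset_simplex by blast
  then have "(1 - e) * (?z $ j) \<ge> e - 1"
    by (simp add: xj)
  moreover have "(1 - e) * (?z $ j) \<le> 0"
    using e laplacian_diag_nonneg by (simp add: mult_nonpos_nonneg)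
  ultimately show False
    using e by simp
qed

lemma interior_lattice_point_eq_0:
  assumes "x \<in> interior_lattice_points (laplacian_polytope D)"
  shows "x = 0"
proof -
  have x: "x \<in> rel_interior (laplacian_polytope D)" and int: "\<And>j. x $ j \<in> \<int>"
    using assms by (auto simp: interior_lattice_points_def)
  have nonneg: "x $ j \<ge> 0" for j
  proof -
    obtain k where k: "x $ j = of_int k"
      using int by (auto elim: Ints_cases)
    moreover have "- 1 < k"
      using rel_interior_laplacian_polytope_gt[OF x, of j] unfolding k by linarith
    ultimately show ?thesis
      by simp
  qed
  moreover have "(\<Sum>j\<in>UNIV. x $ j) = 0"
    using x rel_interior_subset laplacian_polytope_subset_simplex by blast
  ultimately show ?thesis
    by (simp add: sum_nonneg_eq_0_iff vec_eq_iff)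
qed

end

lemma simplex_subset_laplacian_polytope_complete:
  fixes K :: "('n::finite, 'e) pre_digraph"
  assumes "complete_digraph CARD('n) K"
  shows "{x. (\<Sum>j\<in>UNIV. x $ j) = 0 \<and> (\<forall>j. x $ j \<ge> - 1)} \<subseteq> laplacian_polytope K"
proof clarify
  fix x :: "real ^ 'n"
  assume sum0: "(\<Sum>j\<in>UNIV. x $ j) = 0" and ge: "\<forall>j. x $ j \<ge> - 1"
  interpret K: graph K
    using assms by (simp add: complete_digraph_def)
  have "arcs_ends K = {(u, v). u \<noteq> v}"
    using assms complete_digraph_verts_UNIV[OF assms] by (auto simp: complete_digraph_def)
  then have mult: "arc_mult K i j = (if i = j then 0 else 1)" for i j
    by (simp add: K.arc_mult_eq)
  have row: "laplacian_matrix K $ i $ j = (if i = j then real CARD('n) else 0) - 1" for i j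
  proof -
    have "(\<Sum>k\<in>UNIV. real (arc_mult K i k)) = (\<Sum>k\<in>UNIV. 1 - (if i = k then 1 else 0))"
      by (intro sum.cong) (auto simp: mult)
    also have "\<dots> = real CARD('n) - 1"
      by (subst sum_subtractf) simp
    finally show ?thesis
      by (simp only: laplacian_matrix_nth) (simp add: mult)
  qed
  \<comment> \<open>These are barycentric coordinates: row \<open>i\<close> is
    \<open>CARD('n)\<close> times the \<open>i\<close>-th unit vector minus the all-ones vector, so
    weights with sum 1 produce \<open>CARD('n) * ?w j - 1\<close> in coordinate \<open>j\<close>;
    equating this with \<open>x $ j\<close> gives \<open>?w\<close>.\<close>
  let ?w = "\<lambda>i. (x $ i + 1) / real CARD('n)"
  have w: "(\<Sum>i\<in>UNIV. ?w i) = 1"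
    by (simp add: sum0 sum.distrib flip: sum_divide_distrib)
  have "(\<Sum>i\<in>UNIV. ?w i *\<^sub>R laplacian_matrix K $ i) \<in> laplacian_polytope K"
  proof (intro convex_sum laplacian_row_in_polytope w)
    show "0 \<le> ?w i" for i
      using ge[rule_format, of i] by simp
  qed (simp_all add: laplacian_polytope_def)
  moreover have "(\<Sum>i\<in>UNIV. ?w i *\<^sub>R laplacian_matrix K $ i) = x"
  proof (rule vec_eq_iff[THEN iffD2], rule allI)
    fix j
    have "(\<Sum>i\<in>UNIV. ?w i *\<^sub>R laplacian_matrix K $ i) $ j
        = (\<Sum>i\<in>UNIV. (if i = j then x $ i + 1 else 0) - ?w i)"
      by (auto simp: row right_diff_distrib intro!: sum.cong)
    also have "\<dots> = x $ j"
      by (simp only: sum_subtractf w) simp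
    finally show "(\<Sum>i\<in>UNIV. ?w i *\<^sub>R laplacian_matrix K $ i) $ j = x $ j" .
  qed
  ultimately show "x \<in> laplacian_polytope K"
    by simp
qed

context laplacian_digraph
begin

text \<open>Minimum principle: at a vertex where \<open>a\<close> is minimal every term of the
  pairing is nonpositive, so a nonnegative sum forces each term to vanish. Minimality thus passes to
  all out-neighbours, and from \<open>m\<close> every vertex is reachable.\<close>

lemma strongly_connected_superharmonic_const:
  assumes sc: "strongly_connected D"
    and nonneg: "\<And>i. a \<bullet> laplacian_matrix D $ i \<ge> 0"
  shows "a $ i = a $ j"
proof -
  obtain m where m: "\<And>i. a $ m \<le> a $ i"
    using ex_min_if_finite[of "range (($) a)"] by (auto simp: not_less)
  have "a $ v = a $ m" if "m \<rightarrow>\<^sup>*\<^bsub>D\<^esub> v" for v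
    using that
  proof (induction rule: reachable_induct)
    case (step u v)
    let ?t = "\<lambda>j. real (arc_mult D u j) * (a $ u - a $ j)"
    have le: "?t j \<le> 0" for j
      using step.IH m[of j] by (intro mult_nonneg_nonpos) auto
    have "(\<Sum>j\<in>UNIV. ?t j) = 0"
      using nonneg[of u] le by (simp add: inner_laplacian_row sum_nonpos antisym)
    then have "?t v = 0"
      using le sum_nonneg_eq_0_iff[of UNIV "\<lambda>j. - ?t j"] by (simp add: sum_negf)
    moreover have "arc_mult D u v \<noteq> 0"
      using step.hyps by (auto simp: arc_mult_def arcs_ends_conv)
    ultimately show ?case
      using step.IH by simp
  qed simp
  then have "a $ v = a $ m" for v
    using sc by (auto simp: strongly_connected_def verts_UNIV)
  then show ?thesis
    by metis
qed

lemma zero_in_rel_interior_laplacian_polytope: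
  assumes sc: "strongly_connected D"
  shows "0 \<in> rel_interior (laplacian_polytope D)"
proof (rule ccontr)
  let ?P = "laplacian_polytope D"
  assume not_int: "0 \<notin> rel_interior ?P"
  have conv: "convex ?P" and ne: "?P \<noteq> {}" and closed: "closed ?P"
    by (auto simp: laplacian_polytope_alt finite_imp_compact compact_imp_closed compact_convex_hull)
  \<comment> \<open>Strict positivity somewhere is essential, since constant functionals vanish on
    all of \<open>?P\<close>. If \<open>0\<close> lies in \<open>?P\<close>, a supporting hyperplane
    at this relative boundary point provides \<open>a\<close>; otherwise strict separation from the
    closed set \<open>?P\<close> does.\<close>
  have "\<exists>a. (\<forall>y\<in>?P. a \<bullet> y \<ge> 0) \<and> (\<exists>y\<in>?P. a \<bullet> y > 0)"
  proof (cases "0 \<in> ?P")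
    case True
    obtain a where a: "\<And>y. y \<in> ?P \<Longrightarrow> a \<bullet> 0 \<le> a \<bullet> y"
      "\<And>y. y \<in> rel_interior ?P \<Longrightarrow> a \<bullet> 0 < a \<bullet> y"
      using supporting_hyperplane_rel_boundary[OF conv True not_int] by metis
    obtain y where "y \<in> rel_interior ?P"
      using rel_interior_eq_empty[OF conv] ne by blast
    with a have "a \<bullet> y > 0" "y \<in> ?P"
      using rel_interior_subset by auto
    with a(1) show ?thesis
      by auto
  next
    case False
    then obtain a b where "b > 0" "\<forall>y\<in>?P. a \<bullet> y > b"
      using separating_hyperplane_closed_0[OF conv closed] by metis
    then show ?thesis
      using ne by (metis all_not_in_conv less_le_trans less_imp_le)
  qed
  then obtain a y where a: "\<And>y. y \<in> ?P \<Longrightarrow> a \<bullet> y \<ge> 0" and y: "y \<in> ?P" "a \<bullet> y > 0"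
    by blast
  \<comment> \<open>The minimum principle makes \<open>a\<close> constant, so it vanishes on the
    rows and hence on their hull, against \<open>a \<bullet> y > 0\<close>.\<close>
  have "real (arc_mult D i j) * (a $ i - a $ j) = 0" for i j
    using strongly_connected_superharmonic_const[OF sc a[OF laplacian_row_in_polytope], of i j]
    by simp
  then have "a \<bullet> laplacian_matrix D $ i = 0" for i
    unfolding inner_laplacian_row by (intro sum.neutral) blast
  then have "?P \<subseteq> {y. a \<bullet> y = 0}"
    unfolding laplacian_polytope_alt by (intro hull_minimal convex_hyperplane) auto
  with y show False
    by auto
qed

end

theorem proposition14:
  fixes D :: "('n::finite, 'e) pre_digraph"
    and K :: "('n, 'f) pre_digraph"
  assumes "simple_laplacian_digraph D"
    and "complete_digraph CARD('n) K"
  shows "laplacian_polytope D \<subseteq> laplacian_polytope K \<and>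
    (strongly_connected D \<longrightarrow> (\<exists>!x. x \<in> interior_lattice_points (laplacian_polytope D)))"
proof (intro conjI impI)
  interpret simple_laplacian_digraph D
    by fact
  have D: "nomulti_digraph D" "loopfree_digraph D"
    by unfold_locales
  \<comment> \<open>The simplex of zero-sum vectors with entries at least \<open>-1\<close> serves
    as the intermediate set.\<close>
  show "laplacian_polytope D \<subseteq> laplacian_polytope K"
    using laplacian_polytope_subset_simplex[OF D]
      simplex_subset_laplacian_polytope_complete[OF assms(2)] by (rule subset_trans)
  assume "strongly_connected D"
  then have "0 \<in> interior_lattice_points (laplacian_polytope D)"
    using zero_in_rel_interior_laplacian_polytope by (simp add: interior_lattice_points_def)
  then show "\<exists>!x. x \<in> interior_lattice_points (laplacian_polytope D)"
    using interior_lattice_point_eq_0[OF D] by blast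
qed

end
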